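(* There exists an optimal solution $q^*(\cdot)$ to (RAOC) that offers at most $\min\{K+1,n\}$ assortments with positive probability, i.e. $|\{S\subseteq\mathcal N: q^*(S)>0\}|\le\min\{K+1,n\}$.
   Context: Products $\mathcal N=\{1,\dots,n\}$ ($n\ge1$) have revenues $r_i\ge0$ and preference weights $v_i>0$; there are categories $C_1,\dots,C_K\subseteq\mathcal N$ (possibly overlapping) with integer thresholds $0\le\ell_k\le|C_k|$. For $S\subseteq\mathcal N$ let $R(S)=\dfrac{\sum_{i\in S}r_iv_i}{1+\sum_{i\in S}v_i}$. (RAOC) is the problem of maximizing $\sum_{S\subseteq\mathcal N}R(S)q(S)$ over functions $q:2^{\mathcal N}\to\mathbb R$ subject to $\sum_{S\subseteq\mathcal N}|S\cap C_k|q(S)\ge\ell_k$ for all $k\in\{1,\dots,K\}$, $\sum_{S\subseteq\mathcal N}q(S)=1$, and $q(S)\ge0$ for all $S\subseteq\mathcal N$. *)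

theory Defs
  imports Complex_Main
begin

definition revenue :: "(nat \<Rightarrow> real) \<Rightarrow> (nat \<Rightarrow> real) \<Rightarrow> nat set \<Rightarrow> real" where
  "revenue r v S = (\<Sum>i\<in>S. r i * v i) / (1 + (\<Sum>i\<in>S. v i))"

text \<open>A function on the subsets of \<open>{1..n}\<close> is represented by a total function on \<open>nat set\<close>,
  of which only the values on \<open>Pow {1..n}\<close> are used.\<close>

definition raoc_objective ::
    "nat \<Rightarrow> (nat \<Rightarrow> real) \<Rightarrow> (nat \<Rightarrow> real) \<Rightarrow> (nat set \<Rightarrow> real) \<Rightarrow> real" where
  "raoc_objective n r v q = (\<Sum>S\<in>Pow {1..n}. revenue r v S * q S)"

definition raoc_feasible ::
    "nat \<Rightarrow> nat \<Rightarrow> (nat \<Rightarrow> nat set) \<Rightarrow> (nat \<Rightarrow> nat) \<Rightarrow> (nat set \<Rightarrow> real) \<Rightarrow> bool" where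
  "raoc_feasible n K C l q \<longleftrightarrow>
     (\<forall>k\<in>{1..K}. (\<Sum>S\<in>Pow {1..n}. real (card (S \<inter> C k)) * q S) \<ge> real (l k)) \<and>
     (\<Sum>S\<in>Pow {1..n}. q S) = 1 \<and>
     (\<forall>S\<in>Pow {1..n}. q S \<ge> 0)"

definition raoc_optimal ::
    "nat \<Rightarrow> (nat \<Rightarrow> real) \<Rightarrow> (nat \<Rightarrow> real) \<Rightarrow> nat \<Rightarrow> (nat \<Rightarrow> nat set) \<Rightarrow> (nat \<Rightarrow> nat) \<Rightarrow>
      (nat set \<Rightarrow> real) \<Rightarrow> bool" where
  "raoc_optimal n r v K C l q \<longleftrightarrow> is_arg_max (raoc_objective n r v) (raoc_feasible n K C l) q"

end

theory Submission
  imports Defs "HOL-Analysis.Function_Topology"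
begin

text \<open>
  The bound \<open>K + 1\<close> is the usual support bound for a basic solution of a linear program with \<open>K + 1\<close>
  constraints. Applied to the \<open>n\<close> marginal probabilities of the products and the total mass, the
  same argument would only give \<open>n + 1\<close>. The point that saves one constraint is that a product
  \<open>m\<close> of largest revenue can be added to every assortment: this never lowers the revenue
  (\<open>revenue_insert_max\<close>), and it only helps the lower bounds on the categories. So
  some optimal solution offers \<open>m\<close> always, and for such a solution the marginal probability of \<open>m\<close> is
  the total mass.

  Both bounds come from one solution. Among the optimal solutions that always offer \<open>m\<close>,
  take one with the fewest offered assortments. If their number exceeded the number of linear
  functionals in a family that determines feasibility, the mass could be moved along a direction that
  all these functionals ignore until some assortment drops out (\<open>support_shrinks\<close>), against
  minimality. Two families qualify: the total mass with the \<open>K\<close> category loads, and the \<open>n\<close>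
  marginal probabilities, from which the loads are obtained by summation.
\<close>

section \<open>Shrinking the support of a nonnegative solution\<close>

text \<open>Gaussian elimination of one unknown: an equation with a nonzero coefficient at \<open>p\<close> is solved for
  the value at \<open>p\<close>, and substituting this into the other equations leaves one equation and one
  unknown fewer.\<close>

lemma homogeneous_system_nontrivial_solution:
  fixes f :: "'j \<Rightarrow> 'a \<Rightarrow> real"
  assumes "finite J" "finite T" "card J < card T"
  shows "\<exists>d. (\<forall>j\<in>J. (\<Sum>t\<in>T. f j t * d t) = 0) \<and> (\<exists>t\<in>T. d t \<noteq> 0)"
  using assms
proof (induction J arbitrary: T f rule: finite_induct)
  case empty
  then have "T \<noteq> {}" by auto
  then show ?case by (intro exI[of _ "\<lambda>_. 1"]) auto
next
  case (insert j J)
  show ?case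
  proof (cases "\<forall>t\<in>T. f j t = 0")
    case True
    obtain d where "\<forall>i\<in>J. (\<Sum>t\<in>T. f i t * d t) = 0" "\<exists>t\<in>T. d t \<noteq> 0"
      using insert.IH[of T f] insert.prems insert.hyps by auto
    then show ?thesis using True by (intro exI[of _ d]) auto
  next
    case False
    then obtain p where p: "p \<in> T" "f j p \<noteq> 0" by auto
    define T' where "T' = T - {p}"
    have T: "T = insert p T'" "p \<notin> T'" "finite T'"
      using p insert.prems by (auto simp: T'_def)
    have "card J < card T'"
      using insert.prems insert.hyps T by simp
    then obtain d where
      d: "\<And>i. i \<in> J \<Longrightarrow> (\<Sum>t\<in>T'. (f i t - f i p * f j t / f j p) * d t) = 0"
        "\<exists>t\<in>T'. d t \<noteq> 0"
      using insert.IH[of T' "\<lambda>i t. f i t - f i p * f j t / f j p"] T by auto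
    define s where "s = (\<Sum>t\<in>T'. f j t * d t)"
    define e where "e = d(p := - s / f j p)"
    have e_sum: "(\<Sum>t\<in>T. f i t * e t) = (\<Sum>t\<in>T'. f i t * d t) - f i p * s / f j p" for i
    proof -
      have "(\<Sum>t\<in>T'. f i t * e t) = (\<Sum>t\<in>T'. f i t * d t)"
        using T by (intro sum.cong) (auto simp: e_def)
      then show ?thesis using T by (simp add: e_def)
    qed
    have "(\<Sum>t\<in>T. f i t * e t) = 0" if "i \<in> J" for i
    proof -
      have "(\<Sum>t\<in>T'. (f i t - f i p * f j t / f j p) * d t)
          = (\<Sum>t\<in>T'. f i t * d t) - f i p * s / f j p"
        unfolding s_def
        by (simp add: left_diff_distrib sum_subtractf sum_distrib_left sum_divide_distrib
            mult.assoc)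
      then show ?thesis using d(1)[OF that] e_sum by simp
    qed
    moreover have "(\<Sum>t\<in>T. f j t * e t) = 0"
      using e_sum[of j] p by (simp add: s_def)
    moreover have "\<exists>t\<in>T. e t \<noteq> 0"
      using d(2) T by (auto simp: e_def)
    ultimately show ?thesis by auto
  qed
qed

text \<open>There is a nonzero direction on the support of \<open>q\<close> that all \<open>f j\<close> ignore, and up to sign it does
  not lower \<open>c\<close>. Since \<open>f i\<close> is \<open>1\<close> on the support, the entries of the direction sum to zero, so
  some entry is negative. Moving along the direction therefore meets the boundary of the nonnegative
  orthant, where an element leaves the support.\<close>

lemma support_shrinks:
  fixes q c :: "'a \<Rightarrow> real" and f :: "'j \<Rightarrow> 'a \<Rightarrow> real"
  assumes "finite X" and nonneg: "\<forall>x\<in>X. 0 \<le> q x"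
    and "finite J" and card: "card J < card {x\<in>X. 0 < q x}"
    and i: "i \<in> J" "\<And>x. x \<in> X \<Longrightarrow> 0 < q x \<Longrightarrow> f i x = 1"
  shows "\<exists>p. (\<forall>x\<in>X. 0 \<le> p x) \<and>
             (\<forall>j\<in>J. (\<Sum>x\<in>X. f j x * p x) = (\<Sum>x\<in>X. f j x * q x)) \<and>
             (\<Sum>x\<in>X. c x * q x) \<le> (\<Sum>x\<in>X. c x * p x) \<and>
             {x\<in>X. 0 < p x} \<subset> {x\<in>X. 0 < q x}"
proof -
  define T where "T = {x\<in>X. 0 < q x}"
  have finT: "finite T" and TX: "T \<subseteq> X" using \<open>finite X\<close> by (auto simp: T_def)
  obtain d where d: "\<And>j. j \<in> J \<Longrightarrow> (\<Sum>x\<in>T. f j x * d x) = 0" "\<exists>x\<in>T. d x \<noteq> 0"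
    using homogeneous_system_nontrivial_solution[OF \<open>finite J\<close> finT, of f] card
    by (auto simp: T_def)
  define g where
    "g = (if 0 \<le> (\<Sum>x\<in>T. c x * d x) then d else (\<lambda>x. - d x))"
  have g: "\<And>j. j \<in> J \<Longrightarrow> (\<Sum>x\<in>T. f j x * g x) = 0" "\<exists>x\<in>T. g x \<noteq> 0"
      "0 \<le> (\<Sum>x\<in>T. c x * g x)"
    using d by (auto simp: g_def sum_negf)
  have "(\<Sum>x\<in>T. g x) = (\<Sum>x\<in>T. f i x * g x)"
    using i(2) by (intro sum.cong) (auto simp: T_def)
  then have g_sum: "(\<Sum>x\<in>T. g x) = 0" using g(1) i(1) by simp
  define D where "D = {x\<in>T. g x < 0}"
  have "D \<noteq> {}"
  proof
    assume "D = {}"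
    then have "\<forall>x\<in>T. 0 \<le> g x" by (auto simp: D_def not_less[symmetric])
    then have "\<forall>x\<in>T. g x = 0" using g_sum sum_nonneg_eq_0_iff[OF finT, of g] by auto
    then show False using g(2) by auto
  qed
  have finD: "finite D" using finT by (auto simp: D_def)
  \<comment> \<open>the largest step that keeps all entries nonnegative\<close>
  define s where "s = Min ((\<lambda>x. q x / - g x) ` D)"
  have s_le: "s \<le> q x / - g x" if "x \<in> D" for x
    using that finD by (auto simp: s_def)
  have "s \<in> (\<lambda>x. q x / - g x) ` D"
    unfolding s_def using finD \<open>D \<noteq> {}\<close> by (intro Min_in) auto
  then obtain y where y: "y \<in> D" "s = q y / - g y" by auto
  have "0 \<le> s" using y by (auto simp: D_def T_def divide_nonneg_neg divide_nonpos_neg)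
  define p where "p x = q x + (if x \<in> T then s * g x else 0)" for x
  have p_sum: "(\<Sum>x\<in>X. h x * p x) = (\<Sum>x\<in>X. h x * q x) + s * (\<Sum>x\<in>T. h x * g x)"
    for h :: "'a \<Rightarrow> real"
  proof -
    have "(\<Sum>x\<in>X. h x * p x)
        = (\<Sum>x\<in>X. h x * q x) + (\<Sum>x\<in>X. if x \<in> T then s * (h x * g x) else 0)"
      unfolding sum.distrib[symmetric] by (intro sum.cong) (auto simp: p_def algebra_simps)
    also have "(\<Sum>x\<in>X. if x \<in> T then s * (h x * g x) else 0) = (\<Sum>x\<in>T. s * (h x * g x))"
      using TX \<open>finite X\<close> by (simp add: sum.If_cases Int_absorb1)
    finally show ?thesis by (simp add: sum_distrib_left)
  qed
  have "0 \<le> p x" if "x \<in> X" for x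
  proof (cases "x \<in> D")
    case True
    then have "s * - g x \<le> q x" using s_le[OF True] by (simp add: D_def field_simps)
    then show ?thesis using True by (simp add: p_def D_def)
  next
    case False
    then show ?thesis using that nonneg \<open>0 \<le> s\<close> by (auto simp: p_def D_def)
  qed
  moreover have "\<forall>j\<in>J. (\<Sum>x\<in>X. f j x * p x) = (\<Sum>x\<in>X. f j x * q x)"
    using p_sum g(1) by simp
  moreover have "(\<Sum>x\<in>X. c x * q x) \<le> (\<Sum>x\<in>X. c x * p x)"
    using p_sum g(3) \<open>0 \<le> s\<close> by simp
  moreover have "{x\<in>X. 0 < p x} \<subset> {x\<in>X. 0 < q x}"
  proof -
    have "p y = 0" using y by (auto simp: p_def D_def)
    moreover have "y \<in> {x\<in>X. 0 < q x}" using y by (auto simp: D_def T_def)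
    moreover have "{x\<in>X. 0 < p x} \<subseteq> {x\<in>X. 0 < q x}"
      by (auto simp: p_def T_def split: if_splits)
    moreover have "y \<notin> {x\<in>X. 0 < p x}" using \<open>p y = 0\<close> by simp
    ultimately show ?thesis by blast
  qed
  ultimately show ?thesis by blast
qed

section \<open>Existence of an optimal solution\<close>

text \<open>A continuous objective attains its maximum on a compact set. On \<open>Pow {1..n}\<close> a feasible solution
  has values in the unit interval, since they are nonnegative with sum \<open>1\<close>; its other values can be set
  to \<open>0\<close> without changing feasibility or objective. So it suffices to maximize over the feasible
  solutions in the cube with side \<open>{0..1}\<close>, which is compact in the product topology by Tychonoff.\<close>

lemma raoc_optimal_exists:
  assumes "raoc_feasible n K C l q0"
  shows "\<exists>q. raoc_optimal n r v K C l q"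
proof -
  define B :: "(nat set \<Rightarrow> real) set" where "B = (\<Pi>\<^sub>E S\<in>UNIV. {0..1})"
  define F where "F = {q. raoc_feasible n K C l q}"
  have cont: "continuous_on A (\<lambda>q. \<Sum>S\<in>Pow {1..n}. h S * q S)"
    for A and h :: "nat set \<Rightarrow> real"
    by (intro continuous_on_sum continuous_on_mult continuous_on_const)
      (rule continuous_on_subset[OF continuous_on_product_coordinates], simp)
  have "compactin (product_topology (\<lambda>S::nat set. euclidean :: real topology) UNIV) B"
    unfolding B_def by (subst compactin_PiE) auto
  then have "compact B" by (simp add: euclidean_product_topology)
  moreover have "closed F"
  proof -
    have "continuous_on UNIV (\<lambda>q :: nat set \<Rightarrow> real. \<Sum>S\<in>Pow {1..n}. q S)"
      using cont[of UNIV "\<lambda>_. 1"] by simp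
    then show ?thesis
      unfolding F_def raoc_feasible_def Ball_def
      by (intro closed_Collect_conj closed_Collect_all closed_Collect_imp closed_Collect_le
          closed_Collect_eq open_Collect_const cont continuous_on_const
          continuous_on_product_coordinates)
  qed
  ultimately have "compact (B \<inter> F)" by (rule compact_Int_closed)
  moreover have trim: "\<exists>p\<in>B \<inter> F. raoc_objective n r v p = raoc_objective n r v q"
    if "q \<in> F" for q
  proof -
    define p where "p S = (if S \<in> Pow {1..n} then q S else 0)" for S
    have q: "\<forall>S\<in>Pow {1..n}. 0 \<le> q S" "(\<Sum>S\<in>Pow {1..n}. q S) = 1"
      using that by (auto simp: F_def raoc_feasible_def)
    have p_sum: "(\<Sum>S\<in>Pow {1..n}. h S * p S) = (\<Sum>S\<in>Pow {1..n}. h S * q S)" for h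
      by (intro sum.cong) (auto simp: p_def)
    have "q S \<le> 1" if "S \<in> Pow {1..n}" for S
      unfolding q(2)[symmetric] using that q(1) by (intro member_le_sum) auto
    then have "p \<in> B" using q by (auto simp: B_def p_def)
    moreover have "p \<in> F"
      using that p_sum p_sum[of "\<lambda>_. 1"] by (simp add: F_def raoc_feasible_def) (simp add: p_def)
    moreover have "raoc_objective n r v p = raoc_objective n r v q"
      unfolding raoc_objective_def by (rule p_sum)
    ultimately show ?thesis by auto
  qed
  moreover have "B \<inter> F \<noteq> {}"
  proof -
    have "q0 \<in> F" using assms by (simp add: F_def)
    then show ?thesis using trim by blast
  qed
  moreover have "continuous_on (B \<inter> F) (raoc_objective n r v)"
    unfolding raoc_objective_def by (rule cont)
  ultimately obtain q where q: "q \<in> B \<inter> F"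
      "\<And>p. p \<in> B \<inter> F \<Longrightarrow> raoc_objective n r v p \<le> raoc_objective n r v q"
    using continuous_attains_sup[of "B \<inter> F" "raoc_objective n r v"] by auto
  have "raoc_objective n r v p \<le> raoc_objective n r v q" if "p \<in> F" for p
    using trim[OF that] q(2) by fastforce
  then show ?thesis
    using q(1) unfolding raoc_optimal_def is_arg_max_def F_def by (auto simp: not_less)
qed

lemma raoc_feasible_full_assortment:
  assumes "\<And>k. k \<in> {1..K} \<Longrightarrow> C k \<subseteq> {1..n}"
    and "\<And>k. k \<in> {1..K} \<Longrightarrow> l k \<le> card (C k)"
  shows "raoc_feasible n K C l (\<lambda>S. of_bool (S = {1..n}))"
proof -
  have "(\<Sum>S\<in>Pow {1..n}. h S * of_bool (S = {1..n})) = h {1..n}" for h :: "nat set \<Rightarrow> real"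
    by (subst sum.remove[of _ "{1..n}"]) (auto intro!: sum.neutral)
  from this this[of "\<lambda>_. 1"] show ?thesis
    using assms by (simp add: raoc_feasible_def Int_absorb1)
qed

lemma raoc_optimal_better:
  assumes "raoc_optimal n r v K C l q" "raoc_feasible n K C l p"
    and "raoc_objective n r v q \<le> raoc_objective n r v p"
  shows "raoc_optimal n r v K C l p"
  using assms unfolding raoc_optimal_def is_arg_max_def by force

section \<open>A product of largest revenue is always offered\<close>

text \<open>The revenue of an assortment is a weighted average of the \<open>r i\<close> and of the value \<open>0\<close> with weight
  \<open>1\<close>, so it is at most \<open>r m\<close>; adding \<open>m\<close> mixes in the value \<open>r m\<close>.\<close>

lemma revenue_insert_max:
  assumes "finite S" and v: "\<And>i. i \<in> S \<Longrightarrow> 0 \<le> v i" "0 \<le> v m"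
    and r: "0 \<le> r m" "\<And>i. i \<in> S \<Longrightarrow> r i \<le> r m"
  shows "revenue r v S \<le> revenue r v (insert m S)"
proof (cases "m \<in> S")
  case True
  then show ?thesis by (simp add: insert_absorb)
next
  case False
  define V W where "V = (\<Sum>i\<in>S. v i)" and "W = (\<Sum>i\<in>S. r i * v i)"
  have "0 \<le> V" using v by (auto simp: V_def intro: sum_nonneg)
  have "W \<le> r m * V"
    unfolding V_def W_def sum_distrib_left using v r by (intro sum_mono mult_right_mono) auto
  then have "W \<le> r m * (1 + V)" using r by (simp add: algebra_simps)
  then have "W * v m \<le> r m * (1 + V) * v m" using v by (intro mult_right_mono)
  then have "W * (1 + (v m + V)) \<le> (r m * v m + W) * (1 + V)"
    by (simp add: algebra_simps)
  then have "W / (1 + V) \<le> (r m * v m + W) / (1 + (v m + V))"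
    using \<open>0 \<le> V\<close> v(2) by (simp add: pos_divide_le_eq pos_le_divide_eq)
  then show ?thesis
    using False \<open>finite S\<close> by (simp add: revenue_def V_def W_def)
qed

text \<open>The distribution of \<open>insert m S\<close> when \<open>S\<close> is distributed according to \<open>q\<close>.\<close>

definition always_offer :: "nat \<Rightarrow> nat \<Rightarrow> (nat set \<Rightarrow> real) \<Rightarrow> nat set \<Rightarrow> real" where
  "always_offer n m q S = (\<Sum>T\<in>{T\<in>Pow {1..n}. insert m T = S}. q T)"

lemma sum_always_offer:
  assumes "m \<in> {1..n}"
  shows "(\<Sum>S\<in>Pow {1..n}. h S * always_offer n m q S) = (\<Sum>T\<in>Pow {1..n}. h (insert m T) * q T)"
proof -
  have "h S * always_offer n m q S
      = (\<Sum>T\<in>{T\<in>Pow {1..n}. insert m T = S}. h (insert m T) * q T)" for S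
    unfolding always_offer_def sum_distrib_left by (intro sum.cong) auto
  then have "(\<Sum>S\<in>Pow {1..n}. h S * always_offer n m q S)
      = (\<Sum>S\<in>Pow {1..n}. \<Sum>T\<in>{T\<in>Pow {1..n}. insert m T = S}. h (insert m T) * q T)"
    by simp
  also have "\<dots> = (\<Sum>T\<in>Pow {1..n}. h (insert m T) * q T)"
    using assms by (intro sum.group) auto
  finally show ?thesis .
qed

lemma always_offer_support:
  assumes "always_offer n m q S \<noteq> 0"
  shows "m \<in> S"
proof (rule ccontr)
  assume "m \<notin> S"
  then have "{T\<in>Pow {1..n}. insert m T = S} = {}" by auto
  then show False using assms by (simp only: always_offer_def sum.empty)
qed

lemma raoc_optimal_always_offer:
  assumes opt: "raoc_optimal n r v K C l q" and m: "m \<in> {1..n}"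
    and v: "\<And>i. i \<in> {1..n} \<Longrightarrow> 0 \<le> v i"
    and r: "0 \<le> r m" "\<And>i. i \<in> {1..n} \<Longrightarrow> r i \<le> r m"
    and C: "\<And>k. k \<in> {1..K} \<Longrightarrow> C k \<subseteq> {1..n}"
  shows "raoc_optimal n r v K C l (always_offer n m q)"
proof (rule raoc_optimal_better[OF opt])
  have feas: "raoc_feasible n K C l q"
    using opt by (simp add: raoc_optimal_def is_arg_max_def)
  then have nonneg: "0 \<le> q S" if "S \<in> Pow {1..n}" for S
    using that by (simp add: raoc_feasible_def)
  have "real (l k) \<le> (\<Sum>S\<in>Pow {1..n}. real (card (S \<inter> C k)) * always_offer n m q S)"
    if k: "k \<in> {1..K}" for k
  proof -
    have "real (l k) \<le> (\<Sum>S\<in>Pow {1..n}. real (card (S \<inter> C k)) * q S)"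
      using feas k by (simp add: raoc_feasible_def)
    also have "\<dots> \<le> (\<Sum>S\<in>Pow {1..n}. real (card (insert m S \<inter> C k)) * q S)"
      using nonneg finite_subset[OF C[OF k]]
      by (intro sum_mono mult_right_mono of_nat_mono card_mono) auto
    finally show ?thesis
      using sum_always_offer[OF m, of "\<lambda>S. real (card (S \<inter> C k))"] by simp
  qed
  moreover have "(\<Sum>S\<in>Pow {1..n}. always_offer n m q S) = 1"
    using sum_always_offer[OF m, of "\<lambda>_. 1" q] feas by (simp add: raoc_feasible_def)
  moreover have "0 \<le> always_offer n m q S" for S
    unfolding always_offer_def using nonneg by (intro sum_nonneg) auto
  ultimately show "raoc_feasible n K C l (always_offer n m q)"
    by (simp add: raoc_feasible_def)
  have "revenue r v S \<le> revenue r v (insert m S)" if "S \<in> Pow {1..n}" for S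
    using that m v r by (intro revenue_insert_max) (auto intro: finite_subset)
  then show "raoc_objective n r v q \<le> raoc_objective n r v (always_offer n m q)"
    unfolding raoc_objective_def sum_always_offer[OF m]
    using nonneg by (intro sum_mono mult_right_mono) auto
qed

section \<open>The bound on the number of offered assortments\<close>

text \<open>The expected category load is the sum of the marginal probabilities of the products in the
  category.\<close>

lemma sum_card_Int:
  assumes "finite A"
  shows "(\<Sum>S\<in>X. real (card (S \<inter> A)) * q S) = (\<Sum>j\<in>A. \<Sum>S\<in>X. of_bool (j \<in> S) * q S)"
proof -
  have "real (card (S \<inter> A)) = (\<Sum>j\<in>A. of_bool (j \<in> S))" for S
    using assms by (simp add: of_bool_def sum.If_cases Int_commute)
  then show ?thesis by (simp add: sum_distrib_right sum.swap[of _ A])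
qed

theorem proposition8:
  fixes n K :: nat
    and r v :: "nat \<Rightarrow> real"
    and C :: "nat \<Rightarrow> nat set"
    and l :: "nat \<Rightarrow> nat"
  assumes "n \<ge> 1"
    and "\<And>i. i \<in> {1..n} \<Longrightarrow> r i \<ge> 0"
    and "\<And>i. i \<in> {1..n} \<Longrightarrow> v i > 0"
    and "\<And>k. k \<in> {1..K} \<Longrightarrow> C k \<subseteq> {1..n}"
    and "\<And>k. k \<in> {1..K} \<Longrightarrow> l k \<le> card (C k)"
  shows "\<exists>q. raoc_optimal n r v K C l q \<and>
           card {S. S \<subseteq> {1..n} \<and> q S > 0} \<le> min (K + 1) n"
proof -
  let ?X = "Pow {1..n}"
  define supp where "supp q = {S\<in>?X. 0 < q S}" for q :: "nat set \<Rightarrow> real"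
  have "Max (r ` {1..n}) \<in> r ` {1..n}" using \<open>n \<ge> 1\<close> by (intro Max_in) auto
  then obtain m where m: "m \<in> {1..n}" "Max (r ` {1..n}) = r m" by auto
  have r_max: "r i \<le> r m" if "i \<in> {1..n}" for i
    unfolding m(2)[symmetric] using that by (intro Max_ge) auto
  define good where
    "good q \<longleftrightarrow> raoc_optimal n r v K C l q \<and> (\<forall>S\<in>supp q. m \<in> S)" for q
  obtain q0 where "raoc_optimal n r v K C l q0"
    using raoc_optimal_exists[OF raoc_feasible_full_assortment, of K C n l] assms by blast
  then have "raoc_optimal n r v K C l (always_offer n m q0)"
    using m r_max assms by (intro raoc_optimal_always_offer) (auto intro: less_imp_le)
  then have "good (always_offer n m q0)"
    using always_offer_support[of n m q0] by (auto simp: good_def supp_def less_imp_neq[symmetric])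
  then obtain q where q: "good q" and minimal: "\<And>p. good p \<Longrightarrow> card (supp q) \<le> card (supp p)"
    using ex_has_least_nat[of good _ "\<lambda>p. card (supp p)"] by blast
  have opt: "raoc_optimal n r v K C l q" and q_m: "\<And>S. S \<in> supp q \<Longrightarrow> m \<in> S"
    using q by (auto simp: good_def)
  have feas: "raoc_feasible n K C l q"
    using opt by (simp add: raoc_optimal_def is_arg_max_def)
  have nonneg: "\<forall>S\<in>?X. 0 \<le> q S" using feas by (simp add: raoc_feasible_def)
  \<comment> \<open>the functionals need to determine feasibility only within the support of \<open>q\<close>, because
    \<open>support_shrinks\<close> never leaves it\<close>
  have bound: "card (supp q) \<le> card J"
    if J: "finite J" "i \<in> J" "\<And>S. S \<in> supp q \<Longrightarrow> f i S = 1"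
      and determines: "\<And>p. \<lbrakk>\<forall>S\<in>?X. 0 \<le> p S; supp p \<subseteq> supp q;
          \<forall>j\<in>J. (\<Sum>S\<in>?X. f j S * p S) = (\<Sum>S\<in>?X. f j S * q S)\<rbrakk> \<Longrightarrow> raoc_feasible n K C l p"
    for J :: "nat set" and i :: nat and f :: "nat \<Rightarrow> nat set \<Rightarrow> real"
  proof (rule ccontr)
    assume "\<not> card (supp q) \<le> card J"
    then have less: "card J < card {S\<in>?X. 0 < q S}" by (simp add: supp_def)
    have one: "f i S = 1" if "S \<in> ?X" "0 < q S" for S using J(3) that by (auto simp: supp_def)
    obtain p where p: "\<forall>S\<in>?X. 0 \<le> p S"
        "\<forall>j\<in>J. (\<Sum>S\<in>?X. f j S * p S) = (\<Sum>S\<in>?X. f j S * q S)"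
        "(\<Sum>S\<in>?X. revenue r v S * q S) \<le> (\<Sum>S\<in>?X. revenue r v S * p S)"
        "supp p \<subset> supp q"
      using support_shrinks[where f = f and c = "revenue r v", OF _ nonneg J(1) less J(2) one]
      unfolding supp_def by auto
    have "raoc_feasible n K C l p" using determines p by blast
    then have "raoc_optimal n r v K C l p"
      using raoc_optimal_better[OF opt] p(3) by (simp add: raoc_objective_def)
    then have "good p" using p(4) q_m by (auto simp: good_def)
    moreover have "card (supp p) < card (supp q)"
      using p(4) by (intro psubset_card_mono) (auto simp: supp_def)
    ultimately show False using minimal by fastforce
  qed
  \<comment> \<open>index \<open>0\<close> stands for the total mass, index \<open>k \<ge> 1\<close> for the load of category \<open>k\<close>\<close>
  have "card (supp q) \<le> card {0..K}"
  proof (rule bound[of "{0..K}" 0 "\<lambda>k S. if k = 0 then 1 else real (card (S \<inter> C k))"])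
    fix p assume p: "\<forall>S\<in>?X. 0 \<le> p S"
      "\<forall>k\<in>{0..K}. (\<Sum>S\<in>?X. (if k = 0 then 1 else real (card (S \<inter> C k))) * p S)
          = (\<Sum>S\<in>?X. (if k = 0 then 1 else real (card (S \<inter> C k))) * q S)"
    have "(\<Sum>S\<in>?X. p S) = (\<Sum>S\<in>?X. q S)" using bspec[OF p(2), of 0] by simp
    moreover have "(\<Sum>S\<in>?X. real (card (S \<inter> C k)) * p S) = (\<Sum>S\<in>?X. real (card (S \<inter> C k)) * q S)"
      if "k \<in> {1..K}" for k using bspec[OF p(2), of k] that by simp
    ultimately show "raoc_feasible n K C l p" using feas p(1) by (simp add: raoc_feasible_def)
  qed auto
  \<comment> \<open>the marginal probability of \<open>m\<close> takes the place of the total mass\<close>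
  moreover have "card (supp q) \<le> card {1..n}"
  proof (rule bound[of "{1..n}" m "\<lambda>j S. of_bool (j \<in> S)"])
    fix p assume p: "\<forall>S\<in>?X. 0 \<le> p S" "supp p \<subseteq> supp q"
      "\<forall>j\<in>{1..n}. (\<Sum>S\<in>?X. of_bool (j \<in> S) * p S) = (\<Sum>S\<in>?X. of_bool (j \<in> S) * q S)"
    have mass: "(\<Sum>S\<in>?X. u S) = (\<Sum>S\<in>?X. of_bool (m \<in> S) * u S)"
      if "\<forall>S\<in>?X. 0 \<le> u S" "supp u \<subseteq> supp q" for u
    proof (rule sum.cong)
      fix S assume S: "S \<in> ?X"
      then have "u S = 0 \<or> S \<in> supp u" using that(1) by (auto simp: supp_def less_le)
      then show "u S = of_bool (m \<in> S) * u S" using that(2) q_m[of S] by auto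
    qed simp
    have "(\<Sum>S\<in>?X. p S) = (\<Sum>S\<in>?X. q S)"
      using mass[OF p(1,2)] mass[OF nonneg] p(3) m(1) by simp
    moreover have "(\<Sum>S\<in>?X. real (card (S \<inter> C k)) * p S) = (\<Sum>S\<in>?X. real (card (S \<inter> C k)) * q S)"
      if k: "k \<in> {1..K}" for k
    proof -
      have "C k \<subseteq> {1..n}" using assms(4) k by blast
      then have "finite (C k)" and
        "\<And>j. j \<in> C k \<Longrightarrow> (\<Sum>S\<in>?X. of_bool (j \<in> S) * p S) = (\<Sum>S\<in>?X. of_bool (j \<in> S) * q S)"
        using p(3) by (auto intro: finite_subset)
      then show ?thesis by (simp only: sum_card_Int cong: sum.cong)
    qed
    ultimately show "raoc_feasible n K C l p" using feas p(1) by (simp add: raoc_feasible_def)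
  qed (use m q_m in auto)
  ultimately have "card (supp q) \<le> min (K + 1) n" by simp
  moreover have "supp q = {S. S \<subseteq> {1..n} \<and> q S > 0}" by (auto simp: supp_def)
  ultimately show ?thesis using opt by auto
qed

end
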